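(* The class of $(\overline{2P_1+P_2},\,P_2+P_4,\,P_6)$-free graphs is not well-quasi-ordered by the induced subgraph relation.
   Context: Graphs are finite, undirected and simple. $P_r$ is the path on $r$ vertices, $G+H$ is the disjoint union of vertex-disjoint graphs $G,H$, $rG$ is the disjoint union of $r$ copies of $G$, and $\overline{G}$ is the complement of $G$. A graph is $(H_1,\ldots,H_p)$-free if it has no induced subgraph isomorphic to any of $H_1,\ldots,H_p$. The induced subgraph relation is the quasi-order in which $H\leq G$ if and only if $H$ is isomorphic to an induced subgraph of $G$. A quasi-order $\leq$ on a set (or class) $X$ is a well-quasi-order if every infinite sequence $x_1,x_2,\ldots$ in $X$ contains a pair with $x_i\leq x_j$, $i<j$ (equivalently: no infinite strictly decreasing sequence and no infinite antichain). *)

theory Defs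
  imports "Graph_Theory.Digraph_Isomorphism" "Graph_Theory.Pair_Digraph"
begin

text \<open>A finite simple undirected graph is a \<^locale>\<open>pair_graph\<close>: a finite, irreflexive and symmetric
  arc relation, the edge \<open>uv\<close> being the pair of arcs \<open>(u, v)\<close> and \<open>(v, u)\<close>.\<close>

definition path_graph :: "nat \<Rightarrow> nat pair_pre_digraph" where
  "path_graph r = \<lparr> pverts = {..<r},
     parcs = {(u, v). u < r \<and> v < r \<and> (v = Suc u \<or> u = Suc v)} \<rparr>"

definition disjoint_union :: "'a pair_pre_digraph \<Rightarrow> 'b pair_pre_digraph \<Rightarrow> ('a + 'b) pair_pre_digraph"
  where
  "disjoint_union G H = \<lparr> pverts = pverts G <+> pverts H,
     parcs = map_prod Inl Inl ` parcs G \<union> map_prod Inr Inr ` parcs H \<rparr>"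

definition copies :: "nat \<Rightarrow> 'a pair_pre_digraph \<Rightarrow> (nat \<times> 'a) pair_pre_digraph" where
  "copies r G = \<lparr> pverts = {..<r} \<times> pverts G,
     parcs = {((i, u), (j, v)). i < r \<and> j = i \<and> (u, v) \<in> parcs G} \<rparr>"

definition complement_graph :: "'a pair_pre_digraph \<Rightarrow> 'a pair_pre_digraph" where
  "complement_graph G = \<lparr> pverts = pverts G,
     parcs = {(u, v). u \<in> pverts G \<and> v \<in> pverts G \<and> u \<noteq> v \<and> (u, v) \<notin> parcs G} \<rparr>"

definition induced_le :: "'a pair_pre_digraph \<Rightarrow> 'b pair_pre_digraph \<Rightarrow> bool" where
  "induced_le H G \<longleftrightarrow>
     (\<exists>F. induced_subgraph F (with_proj G) \<and> digraph_iso (with_proj H) F)"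

abbreviation induced_free :: "'a pair_pre_digraph \<Rightarrow> 'b pair_pre_digraph \<Rightarrow> bool" where
  "induced_free H G \<equiv> \<not> induced_le H G"

text \<open>The predicate below is meant for quasi-orders. Reflexivity and transitivity are not conjuncts, so
  its negation asserts the existence of an infinite sequence without a good pair; that
  \<^const>\<open>induced_le\<close> is a quasi-order on graphs is \<open>reflp_on_induced_le\<close> and \<open>transp_on_induced_le\<close>.\<close>

definition wqo_on :: "('a \<Rightarrow> 'a \<Rightarrow> bool) \<Rightarrow> 'a set \<Rightarrow> bool" where
  "wqo_on le X \<longleftrightarrow>
     (\<forall>x :: nat \<Rightarrow> 'a. (\<forall>i. x i \<in> X) \<longrightarrow> (\<exists>i j. i < j \<and> le (x i) (x j)))"

lemma pair_graph_iff:
  "pair_graph G \<longleftrightarrow> finite (pverts G) \<and> parcs G \<subseteq> pverts G \<times> pverts G \<and> irrefl (parcs G) \<and> sym (parcs G)"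
proof
  assume "pair_graph G"
  then interpret pair_graph G .
  have "sym (parcs G)" using pair_sym_arcs by (simp add: symmetric_def)
  moreover have "irrefl (parcs G)" using pair_no_loops unfolding irrefl_def by (metis fst_conv snd_conv)
  moreover have "parcs G \<subseteq> pverts G \<times> pverts G" by (auto dest: in_arcsD1 in_arcsD2)
  ultimately show "finite (pverts G) \<and> parcs G \<subseteq> pverts G \<times> pverts G \<and> irrefl (parcs G) \<and> sym (parcs G)"
    using pair_finite_verts by blast
next
  assume *: "finite (pverts G) \<and> parcs G \<subseteq> pverts G \<times> pverts G \<and> irrefl (parcs G) \<and> sym (parcs G)"
  then have "finite (parcs G)" by (meson finite_SigmaI finite_subset)
  with * show "pair_graph G"
    by unfold_locales (auto simp: symmetric_def irrefl_def)
qed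

lemma pair_graph_path_graph: "pair_graph (path_graph r)"
  by (auto simp: pair_graph_iff path_graph_def irrefl_def sym_def)

lemma pair_graph_disjoint_union:
  "pair_graph G \<Longrightarrow> pair_graph H \<Longrightarrow> pair_graph (disjoint_union G H)"
  by (fastforce simp: pair_graph_iff disjoint_union_def irrefl_def sym_def)

lemma pair_graph_copies: "pair_graph G \<Longrightarrow> pair_graph (copies r G)"
  by (auto simp: pair_graph_iff copies_def irrefl_def sym_def)

lemma pair_graph_complement_graph: "pair_graph G \<Longrightarrow> pair_graph (complement_graph G)"
  by (auto simp: pair_graph_iff complement_graph_def irrefl_def sym_def)

lemma induced_le_iff:
  assumes "pair_graph H" "pair_graph G"
  shows "induced_le H G \<longleftrightarrow>
    (\<exists>f. inj_on f (pverts H) \<and> f ` pverts H \<subseteq> pverts G \<and>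
      (\<forall>u\<in>pverts H. \<forall>v\<in>pverts H. (u, v) \<in> parcs H \<longleftrightarrow> (f u, f v) \<in> parcs G))"
proof
  interpret H: pair_graph H by fact
  interpret G: pair_graph G by fact
  {
    assume "induced_le H G"
    then obtain F h where F: "induced_subgraph F (with_proj G)"
      and h: "pre_digraph.digraph_isomorphism (with_proj H) h" "F = app_iso h (with_proj H)"
      by (auto simp: induced_le_def digraph_iso_def)
    let ?f = "iso_verts h"
    have inj: "inj_on ?f (pverts H)"
      using h(1) by (simp add: pre_digraph.digraph_isomorphism_def)
    have ht: "iso_tail h = fst" "iso_head h = snd"
      using F h(2) by (auto simp: induced_subgraph_def subgraph_def compatible_def)
    have arc: "iso_arcs h a = (?f (fst a), ?f (snd a))" if "a \<in> parcs H" for a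
      using h(1) ht that by (simp add: pre_digraph.digraph_isomorphism_def prod_eq_iff)
    have sub: "?f ` pverts H \<subseteq> pverts G"
      using F h(2) by (auto simp: induced_subgraph_def subgraph_def)
    have arcs: "iso_arcs h ` parcs H
        = {e \<in> parcs G. fst e \<in> ?f ` pverts H \<and> snd e \<in> ?f ` pverts H}"
      using F h(2) by (simp add: induced_subgraph_def)
    have "(u, v) \<in> parcs H \<longleftrightarrow> (?f u, ?f v) \<in> parcs G"
      if uv: "u \<in> pverts H" "v \<in> pverts H" for u v
    proof
      assume "(u, v) \<in> parcs H"
      then have "(?f u, ?f v) \<in> iso_arcs h ` parcs H"
        using arc[of "(u, v)"] by (intro image_eqI[of _ _ "(u, v)"]) simp_all
      then show "(?f u, ?f v) \<in> parcs G" using arcs by blast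
    next
      assume "(?f u, ?f v) \<in> parcs G"
      then have "(?f u, ?f v) \<in> iso_arcs h ` parcs H" unfolding arcs using uv by simp
      then obtain a where a: "a \<in> parcs H" "(?f u, ?f v) = iso_arcs h a" by (rule imageE)
      with arc have "?f u = ?f (fst a)" "?f v = ?f (snd a)" by simp_all
      then have "u = fst a" "v = snd a"
        using inj_onD[OF inj] uv H.arc_fst_in_verts[OF a(1)] H.arc_snd_in_verts[OF a(1)] by blast+
      with a show "(u, v) \<in> parcs H" by simp
    qed
    with inj sub show "\<exists>f. inj_on f (pverts H) \<and> f ` pverts H \<subseteq> pverts G \<and>
      (\<forall>u\<in>pverts H. \<forall>v\<in>pverts H. (u, v) \<in> parcs H \<longleftrightarrow> (f u, f v) \<in> parcs G)"
      by blast
  next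
    assume "\<exists>f. inj_on f (pverts H) \<and> f ` pverts H \<subseteq> pverts G \<and>
      (\<forall>u\<in>pverts H. \<forall>v\<in>pverts H. (u, v) \<in> parcs H \<longleftrightarrow> (f u, f v) \<in> parcs G)"
    then obtain f where inj: "inj_on f (pverts H)" and sub: "f ` pverts H \<subseteq> pverts G"
      and e: "\<And>u v. u \<in> pverts H \<Longrightarrow> v \<in> pverts H \<Longrightarrow> (u, v) \<in> parcs H \<longleftrightarrow> (f u, f v) \<in> parcs G"
      by blast
    define h where "h = \<lparr> iso_verts = f, iso_arcs = map_prod f f, iso_head = snd, iso_tail = fst \<rparr>"
    have "inj_on (map_prod f f) (parcs H)"
      by (rule inj_on_subset[OF map_prod_inj_on[OF inj inj]])
        (auto dest: H.in_arcsD1 H.in_arcsD2)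
    then have "pre_digraph.digraph_isomorphism (with_proj H) h"
      using inj H.wf_digraph by (simp add: pre_digraph.digraph_isomorphism_def h_def)
    moreover have "app_iso h (with_proj H) = with_proj G \<restriction> (f ` pverts H)"
    proof -
      have "map_prod f f ` parcs H = {x \<in> parcs G. fst x \<in> f ` pverts H \<and> snd x \<in> f ` pverts H}"
        (is "_ = ?R")
      proof
        show "map_prod f f ` parcs H \<subseteq> ?R"
        proof
          fix x assume "x \<in> map_prod f f ` parcs H"
          then obtain u v where uv: "(u, v) \<in> parcs H" "x = (f u, f v)" by auto
          then have "u \<in> pverts H" "v \<in> pverts H" by (auto dest: H.in_arcsD1 H.in_arcsD2)
          with uv e[of u v] show "x \<in> ?R" by simp
        qed
        show "?R \<subseteq> map_prod f f ` parcs H"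
        proof
          fix x assume "x \<in> ?R"
          then obtain u v where uv: "u \<in> pverts H" "v \<in> pverts H" "x = (f u, f v)" "x \<in> parcs G"
            by (cases x) auto
          then have "(u, v) \<in> parcs H" using e[of u v] by simp
          then show "x \<in> map_prod f f ` parcs H"
            unfolding uv(3) by (intro image_eqI[of _ _ "(u, v)"]) simp_all
        qed
      qed
      then show ?thesis by (simp add: app_iso_def induce_subgraph_def h_def)
    qed
    moreover have "induced_subgraph (with_proj G \<restriction> (f ` pverts H)) (with_proj G)"
      using sub by (intro G.induced_induce) simp
    ultimately show "induced_le H G"
      unfolding induced_le_def digraph_iso_def
      by (intro exI[of _ "with_proj G \<restriction> (f ` pverts H)"] conjI exI[of _ h]) simp_all
  }
qed

lemma reflp_on_induced_le: "reflp_on {G. pair_graph G} induced_le"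
proof (rule reflp_onI)
  fix G :: "'a pair_pre_digraph" assume "G \<in> {G. pair_graph G}"
  then show "induced_le G G"
    by (subst induced_le_iff) (auto intro: exI[of _ "\<lambda>x. x"])
qed

lemma transp_on_induced_le: "transp_on {G. pair_graph G} induced_le"
proof (rule transp_onI)
  fix G H K :: "'a pair_pre_digraph"
  assume *: "G \<in> {G. pair_graph G}" "H \<in> {G. pair_graph G}" "K \<in> {G. pair_graph G}"
    and le: "induced_le G H" "induced_le H K"
  obtain f where f: "inj_on f (pverts G)" "f ` pverts G \<subseteq> pverts H"
      "\<forall>u\<in>pverts G. \<forall>v\<in>pverts G. (u, v) \<in> parcs G \<longleftrightarrow> (f u, f v) \<in> parcs H"
    using le(1) * induced_le_iff[of G H] by blast
  obtain g where g: "inj_on g (pverts H)" "g ` pverts H \<subseteq> pverts K"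
      "\<forall>u\<in>pverts H. \<forall>v\<in>pverts H. (u, v) \<in> parcs H \<longleftrightarrow> (g u, g v) \<in> parcs K"
    using le(2) * induced_le_iff[of H K] by blast
  have "inj_on (g \<circ> f) (pverts G)"
    by (rule comp_inj_on[OF f(1) inj_on_subset[OF g(1) f(2)]])
  moreover have "(g \<circ> f) ` pverts G \<subseteq> pverts K"
    using f(2) g(2) by (auto simp: image_subset_iff)
  moreover have "\<forall>u\<in>pverts G. \<forall>v\<in>pverts G.
      (u, v) \<in> parcs G \<longleftrightarrow> ((g \<circ> f) u, (g \<circ> f) v) \<in> parcs K"
  proof (intro ballI)
    fix u v assume "u \<in> pverts G" "v \<in> pverts G"
    moreover from this f(2) have "f u \<in> pverts H" "f v \<in> pverts H" by auto
    ultimately show "(u, v) \<in> parcs G \<longleftrightarrow> ((g \<circ> f) u, (g \<circ> f) v) \<in> parcs K"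
      using f(3) g(3) unfolding comp_def by blast
  qed
  ultimately show "induced_le G K"
    using induced_le_iff[of G K] * by blast
qed

end

theory Submission
  imports Defs
begin

text \<open>The antichain consists of the cycles on \<open>4n\<close> vertices in which the vertices \<open>\<equiv> 0\<close> and those
  \<open>\<equiv> 2\<close> modulo \<open>4\<close> are joined completely. Put differently, these are the graphs obtained from
  \<open>K\<^sub>n\<^sub>,\<^sub>n\<close> by fixing a Hamiltonian cycle and erecting a triangle over each of its edges; the apexes
  of the triangles are the odd vertices. An odd vertex has exactly one neighbour in each side of
  the bipartition, and at most one odd vertex lies over a given edge, which excludes the three
  forbidden subgraphs. An embedding preserves parity because even vertices have degree at least
  three, and it therefore maps consecutive vertices of the cycle to consecutive ones; so it is
  onto.\<close>

definition cycle_succ :: "nat \<Rightarrow> nat \<Rightarrow> nat" where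
  "cycle_succ n u = (if Suc u = 4 * n then 0 else Suc u)"

definition cycle_adj :: "nat \<Rightarrow> nat \<Rightarrow> nat \<Rightarrow> bool" where
  "cycle_adj n u v \<longleftrightarrow> u < 4 * n \<and> v < 4 * n \<and>
     (v = cycle_succ n u \<or> u = cycle_succ n v \<or> even u \<and> even v \<and> u mod 4 \<noteq> v mod 4)"

definition triangled_cycle :: "nat \<Rightarrow> nat pair_pre_digraph" where
  "triangled_cycle n = \<lparr> pverts = {..<4 * n}, parcs = {(u, v). cycle_adj n u v} \<rparr>"

lemma parity_cycle_succ: "even (cycle_succ n u) \<longleftrightarrow> odd u"
proof (cases "Suc u = 4 * n")
  case True
  then have "odd u" by presburger
  with True show ?thesis by (simp add: cycle_succ_def)
qed (simp add: cycle_succ_def)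

text \<open>The length of the cycle is a multiple of 4, so wrapping around is invisible to residues
  modulo 4.\<close>

lemma cycle_succ_mod_4: "cycle_succ n u mod 4 = Suc u mod 4"
  by (auto simp: cycle_succ_def)

text \<open>Two steps shift the residue by 2. For odd vertices this puts the two neighbours on
  opposite sides of the bipartition.\<close>

lemma cycle_succ_succ_mod_4: "cycle_succ n (cycle_succ n u) mod 4 \<noteq> u mod 4"
proof -
  have "cycle_succ n (cycle_succ n u) mod 4 = Suc (Suc u) mod 4"
    by (metis cycle_succ_mod_4 mod_Suc_eq)
  also have "\<dots> \<noteq> u mod 4" by presburger
  finally show ?thesis .
qed

lemma cycle_succ_less: "u < 4 * n \<Longrightarrow> cycle_succ n u < 4 * n"
  by (auto simp: cycle_succ_def)

text \<open>No range condition appears because the wrap-around is a case distinction; reduction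
  modulo \<open>4 * n\<close> would identify vertices outside the range.\<close>

lemma cycle_succ_inject: "cycle_succ n u = cycle_succ n v \<longleftrightarrow> u = v"
  by (auto simp: cycle_succ_def)

lemma cycle_pred_exists:
  assumes "v < 4 * n"
  obtains u where "u < 4 * n" "cycle_succ n u = v"
proof (cases v)
  case 0
  then show ?thesis using assms by (intro that[of "4 * n - 1"]) (auto simp: cycle_succ_def)
next
  case (Suc u)
  then show ?thesis using assms by (intro that[of u]) (auto simp: cycle_succ_def)
qed

lemma cycle_adj_sym: "cycle_adj n u v \<Longrightarrow> cycle_adj n v u"
  by (auto simp: cycle_adj_def)

text \<open>Cycle edges join vertices of opposite parity, so only the complete bipartite join
  remains between even vertices.\<close>

lemma cycle_adj_even:
  assumes "even u" "even v" "u < 4 * n" "v < 4 * n"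
  shows "cycle_adj n u v \<longleftrightarrow> u mod 4 \<noteq> v mod 4"
  using assms parity_cycle_succ[of n u] parity_cycle_succ[of n v] by (auto simp: cycle_adj_def)

lemma cycle_adj_odd:
  assumes "odd u"
  shows "cycle_adj n u v \<longleftrightarrow> u < 4 * n \<and> v < 4 * n \<and> (v = cycle_succ n u \<or> u = cycle_succ n v)"
  using assms by (auto simp: cycle_adj_def)

lemma cycle_adj_odd_even: "cycle_adj n u v \<Longrightarrow> odd u \<Longrightarrow> even v"
  using parity_cycle_succ by (auto simp: cycle_adj_odd)

text \<open>Pigeonhole on the residues 0 and 2: the even vertices have just two sides, hence span no
  triangle.\<close>

lemma mod_4_of_three:
  fixes a b c :: nat
  assumes "even a" "even b" "even c"
  shows "a mod 4 = b mod 4 \<or> b mod 4 = c mod 4 \<or> a mod 4 = c mod 4"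
proof -
  have "k mod 4 = 0 \<or> k mod 4 = 2" if "even k" for k :: nat
    using that by presburger
  then show ?thesis using assms by metis
qed

lemma odd_neighbour_unique:
  assumes x: "odd x" and adj: "cycle_adj n x a" "cycle_adj n x b" and eq: "a mod 4 = b mod 4"
  shows "a = b"
proof -
  have *: "cycle_succ n x mod 4 \<noteq> c mod 4" if "x = cycle_succ n c" for c
    using cycle_succ_succ_mod_4 by (simp add: that)
  show ?thesis
    using adj eq * cycle_succ_inject[of n a b] unfolding cycle_adj_odd[OF x] by metis
qed

text \<open>Two distinct apexes over \<open>a\<close> and \<open>b\<close> would lie on the two
  different arcs between them, so that four steps lead from \<open>a\<close> back to
  \<open>a\<close>; a cycle of length at least 8 forbids this.\<close>

lemma apex_unique:
  assumes n: "n \<ge> 2" and odd: "odd x" "odd y"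
    and adj: "cycle_adj n x a" "cycle_adj n x b" "cycle_adj n y a" "cycle_adj n y b"
    and ne: "a \<noteq> b"
  shows "x = y"
proof (rule ccontr)
  assume "x \<noteq> y"
  have opposite: "(a = cycle_succ n z \<and> z = cycle_succ n b) \<or> (b = cycle_succ n z \<and> z = cycle_succ n a)"
    if "odd z" "cycle_adj n z a" "cycle_adj n z b" for z
    using that(2,3) ne cycle_succ_inject[of n a b] unfolding cycle_adj_odd[OF that(1)] by metis
  have "cycle_succ n (cycle_succ n (cycle_succ n (cycle_succ n a))) = a"
    using opposite[OF odd(1) adj(1,2)] opposite[OF odd(2) adj(3,4)] \<open>x \<noteq> y\<close> cycle_succ_inject[of n x y]
    by metis
  then show False using n by (auto simp: cycle_succ_def split: if_splits)
qed

lemma pair_graph_triangled_cycle: "pair_graph (triangled_cycle n)"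
proof -
  have "\<not> cycle_adj n u u" for u
    using parity_cycle_succ[of n u] by (auto simp: cycle_adj_def)
  then show ?thesis
    by (auto simp: pair_graph_iff triangled_cycle_def irrefl_def sym_def cycle_adj_def)
qed

lemma induced_le_triangled_cycleE:
  assumes "pair_graph H" "induced_le H (triangled_cycle n)"
  obtains f where "inj_on f (pverts H)" "\<And>u. u \<in> pverts H \<Longrightarrow> f u < 4 * n"
    "\<And>u v. u \<in> pverts H \<Longrightarrow> v \<in> pverts H \<Longrightarrow> cycle_adj n (f u) (f v) \<longleftrightarrow> (u, v) \<in> parcs H"
  using assms(2) unfolding induced_le_iff[OF assms(1) pair_graph_triangled_cycle]
  by (auto simp: triangled_cycle_def image_subset_iff)

section \<open>The three forbidden induced subgraphs\<close>

lemma triangled_cycle_diamond_free: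
  assumes n: "n \<ge> 2"
  shows "induced_free (complement_graph (disjoint_union (copies 2 (path_graph 1)) (path_graph 2)))
    (triangled_cycle n)" (is "induced_free ?H _")
proof
  assume "induced_le ?H (triangled_cycle n)"
  then obtain f where inj: "inj_on f (pverts ?H)" and lt: "\<And>u. u \<in> pverts ?H \<Longrightarrow> f u < 4 * n"
    and f: "\<And>u v. u \<in> pverts ?H \<Longrightarrow> v \<in> pverts ?H \<Longrightarrow> cycle_adj n (f u) (f v) \<longleftrightarrow> (u, v) \<in> parcs ?H"
    by (rule induced_le_triangled_cycleE[OF pair_graph_complement_graph[OF pair_graph_disjoint_union[OF
          pair_graph_copies[OF pair_graph_path_graph] pair_graph_path_graph]]]) (rule that)
  note defs = complement_graph_def disjoint_union_def copies_def path_graph_def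
  \<comment> \<open>The forbidden graph is the diamond: \<open>r\<close> and \<open>t\<close> are
    the adjacent vertices of degree 3, \<open>p\<close> and \<open>q\<close> the non-adjacent
    pair.\<close>
  define r t p q where "r = f (Inl (0, 0))" "t = f (Inl (1, 0))" "p = f (Inr 0)" "q = f (Inr 1)"
  note pqrt = this
  have V: "Inl (0, 0) \<in> pverts ?H" "Inl (1, 0) \<in> pverts ?H" "Inr 0 \<in> pverts ?H" "Inr 1 \<in> pverts ?H"
    by (auto simp: defs)
  have ne: "p \<noteq> q" "r \<noteq> t"
    using inj_onD[OF inj] V unfolding pqrt by (metis Inr_inject zero_neq_one, metis Inl_inject prod.inject zero_neq_one)
  have adj: "cycle_adj n r t" "cycle_adj n r p" "cycle_adj n r q" "cycle_adj n t p" "cycle_adj n t q"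
    unfolding pqrt f[OF V(1) V(2)] f[OF V(1) V(3)] f[OF V(1) V(4)] f[OF V(2) V(3)] f[OF V(2) V(4)]
    by (auto simp: defs)
  have less: "r < 4 * n" "t < 4 * n" "p < 4 * n" "q < 4 * n"
    using lt V by (auto simp: pqrt)
  \<comment> \<open>A degree-3 vertex of the diamond cannot be odd: its neighbours would be even,
    and \<open>p\<close> and \<open>q\<close>, both adjacent to \<open>y\<close>, would share a
    side.\<close>
  have apex: False if "odd x" "cycle_adj n x y" "cycle_adj n x p" "cycle_adj n x q"
      "cycle_adj n y p" "cycle_adj n y q" "y < 4 * n" for x y
  proof -
    have ev: "even y" "even p" "even q" using that cycle_adj_odd_even by blast+
    then have "p mod 4 = q mod 4"
      using that less cycle_adj_even[of y p n] cycle_adj_even[of y q n] mod_4_of_three[OF ev] by auto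
    then show False using that odd_neighbour_unique ne by blast
  qed
  have rt: "even r" "even t"
    using apex[of r t] apex[of t r] adj less cycle_adj_sym by blast+
  \<comment> \<open>The even adjacent vertices \<open>r\<close> and \<open>t\<close> occupy both
    sides, so a common neighbour must be an apex; \<open>p\<close> and \<open>q\<close> would then
    be two apexes over one edge.\<close>
  have "odd w" if "cycle_adj n r w" "cycle_adj n t w" "w < 4 * n" for w
  proof
    assume "even w"
    then show False
      using that rt less adj(1) cycle_adj_even[of r w n] cycle_adj_even[of t w n] cycle_adj_even[of r t n]
        mod_4_of_three[of r t w] by auto
  qed
  then have "odd p" "odd q" using adj less by blast+
  then show False using apex_unique[OF n, of p q r t] adj ne cycle_adj_sym by blast
qed

lemma triangled_cycle_P2_P4_free:
  "induced_free (disjoint_union (path_graph 2) (path_graph 4)) (triangled_cycle n)"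
  (is "induced_free ?H _")
proof
  assume "induced_le ?H (triangled_cycle n)"
  then obtain f where inj: "inj_on f (pverts ?H)" and lt: "\<And>u. u \<in> pverts ?H \<Longrightarrow> f u < 4 * n"
    and f: "\<And>u v. u \<in> pverts ?H \<Longrightarrow> v \<in> pverts ?H \<Longrightarrow> cycle_adj n (f u) (f v) \<longleftrightarrow> (u, v) \<in> parcs ?H"
    by (rule induced_le_triangled_cycleE[OF pair_graph_disjoint_union[OF
          pair_graph_path_graph pair_graph_path_graph]]) (rule that)
  note defs = disjoint_union_def path_graph_def
  have l: "Inl i \<in> pverts ?H \<longleftrightarrow> i < 2" and r: "Inr j \<in> pverts ?H \<longleftrightarrow> j < 4" for i j
    by (auto simp: defs)
  have lr: "\<not> cycle_adj n (f (Inl i)) (f (Inr j))" if "i < 2" "j < 4" for i j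
    using f[of "Inl i" "Inr j"] that l r by (auto simp: defs)
  have rr: "cycle_adj n (f (Inr i)) (f (Inr j)) \<longleftrightarrow> j = Suc i \<or> i = Suc j" if "i < 4" "j < 4" for i j
    using f[of "Inr i" "Inr j"] that l r by (auto simp: defs)
  have "cycle_adj n (f (Inl 0)) (f (Inl 1))"
    using f[of "Inl 0" "Inl 1"] l by (auto simp: defs)
  \<comment> \<open>One end of the edge \<open>P2\<close> is even. Being non-adjacent to all of
    \<open>P4\<close>, it forces the even vertices of \<open>P4\<close> onto its own side.\<close>
  then obtain i where i: "i < 2" "even (f (Inl i))"
    using cycle_adj_odd_even by (metis one_less_numeral_iff pos2 semiring_norm(76))
  define g where "g j = f (Inr j)" for j
  have glt: "g j < 4 * n" if "j < 4" for j using that lt r by (simp add: g_def)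
  have side: "g j mod 4 = f (Inl i) mod 4" if "even (g j)" "j < 4" for j
    using lr[OF i(1) that(2)] cycle_adj_even[of "f (Inl i)" "g j" n] that i glt lt l by (auto simp: g_def)
  \<comment> \<open>An odd inner vertex of \<open>P4\<close> would have two even neighbours on the
    same side.\<close>
  have mid: False if "odd (g (Suc j))" "j < 2" for j
  proof -
    have "cycle_adj n (g (Suc j)) (g j)" "cycle_adj n (g (Suc j)) (g (Suc (Suc j)))"
      using rr that(2) by (auto simp: g_def)
    moreover from this have "g j mod 4 = g (Suc (Suc j)) mod 4"
      using side that cycle_adj_odd_even by simp
    ultimately have "g j = g (Suc (Suc j))" using that(1) odd_neighbour_unique by blast
    then show False using inj_onD[OF inj, of "Inr j" "Inr (Suc (Suc j))"] r that(2) by (simp add: g_def)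
  qed
  have "even (g 1)" "even (g 2)" using mid[of 0] mid[of 1] by (auto simp: numeral_2_eq_2)
  moreover have "cycle_adj n (g 1) (g 2)" using rr by (simp add: g_def)
  ultimately show False using cycle_adj_even[of "g 1" "g 2" n] side glt by simp
qed

text \<open>The four inner vertices turn out to be even, and a complete bipartite graph contains no
  induced \<open>P4\<close>.\<close>

lemma triangled_cycle_P6_free: "induced_free (path_graph 6) (triangled_cycle n)"
proof
  assume "induced_le (path_graph 6) (triangled_cycle n)"
  then obtain f where inj: "inj_on f (pverts (path_graph 6))"
    and lt': "\<And>u. u \<in> pverts (path_graph 6) \<Longrightarrow> f u < 4 * n"
    and f': "\<And>u v. u \<in> pverts (path_graph 6) \<Longrightarrow> v \<in> pverts (path_graph 6) \<Longrightarrow>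
      cycle_adj n (f u) (f v) \<longleftrightarrow> (u, v) \<in> parcs (path_graph 6)"
    by (rule induced_le_triangled_cycleE[OF pair_graph_path_graph]) (rule that)
  have lt: "f i < 4 * n" if "i < 6" for i using lt' that by (simp add: path_graph_def)
  have f: "cycle_adj n (f i) (f j) \<longleftrightarrow> j = Suc i \<or> i = Suc j" if "i < 6" "j < 6" for i j
    using f' that by (auto simp: path_graph_def)
  have mid: "even (f (Suc j))" if "j < 4" for j
  proof (rule ccontr)
    assume odd: "odd (f (Suc j))"
    have adj: "cycle_adj n (f (Suc j)) (f j)" "cycle_adj n (f (Suc j)) (f (Suc (Suc j)))"
      using f that by auto
    then have "even (f j)" "even (f (Suc (Suc j)))" using odd cycle_adj_odd_even by blast+
    moreover have "\<not> cycle_adj n (f j) (f (Suc (Suc j)))" using f that by simp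
    ultimately have "f j mod 4 = f (Suc (Suc j)) mod 4"
      using cycle_adj_even[of "f j" "f (Suc (Suc j))" n] lt that by simp
    then have "f j = f (Suc (Suc j))" using odd_neighbour_unique[OF odd] adj by blast
    then show False using inj_onD[OF inj, of j "Suc (Suc j)"] that by (simp add: path_graph_def)
  qed
  have ev: "even (f 1)" "even (f 2)" "even (f 3)" "even (f 4)"
    using mid[of 0] mid[of 1] mid[of 2] mid[of 3] by (simp_all add: eval_nat_numeral)
  have "f 1 mod 4 \<noteq> f 2 mod 4" "f 2 mod 4 \<noteq> f 3 mod 4" "f 3 mod 4 \<noteq> f 4 mod 4"
    "f 1 mod 4 = f 4 mod 4"
    using f[of 1 2] f[of 2 3] f[of 3 4] f[of 1 4] ev lt
    by (simp_all add: cycle_adj_even)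
  then show False using mod_4_of_three[OF ev(1,2,3)] by simp
qed

section \<open>Embeddings between triangled cycles\<close>

lemma triangled_cycle_embedding_imp_eq:
  assumes m: "m \<ge> 2" and le: "induced_le (triangled_cycle m) (triangled_cycle n)"
  shows "m = n"
proof -
  obtain f where inj': "inj_on f (pverts (triangled_cycle m))"
    and lt': "\<And>u. u \<in> pverts (triangled_cycle m) \<Longrightarrow> f u < 4 * n"
    and f': "\<And>u v. u \<in> pverts (triangled_cycle m) \<Longrightarrow> v \<in> pverts (triangled_cycle m) \<Longrightarrow>
      cycle_adj n (f u) (f v) \<longleftrightarrow> (u, v) \<in> parcs (triangled_cycle m)"
    by (rule induced_le_triangled_cycleE[OF pair_graph_triangled_cycle le]) (rule that)
  have inj: "inj_on f {..<4 * m}" using inj' by (simp add: triangled_cycle_def)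
  have lt: "f u < 4 * n" if "u < 4 * m" for u using lt' that by (simp add: triangled_cycle_def)
  have f: "cycle_adj n (f u) (f v) \<longleftrightarrow> cycle_adj m u v" if "u < 4 * m" "v < 4 * m" for u v
    using f' that by (simp add: triangled_cycle_def)
  let ?s = "cycle_succ m"
  have adj_succ: "cycle_adj m u (?s u)" if "u < 4 * m" for u
    using that cycle_succ_less by (simp add: cycle_adj_def)
  have adj_succ2: "cycle_adj m u (?s (?s u))" if "u < 4 * m" "even u" for u
    using that cycle_succ_less parity_cycle_succ not_sym[OF cycle_succ_succ_mod_4]
    by (simp add: cycle_adj_even)
  \<comment> \<open>An even \<open>u\<close> has three distinct neighbours in \<open>?N\<close>. If
    \<open>f u\<close> were odd, their images would be even with pairwise different residues modulo
    4.\<close>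
  have even: "even (f u)" if u: "u < 4 * m" "even u" for u
  proof (rule ccontr)
    assume odd: "odd (f u)"
    obtain w where w: "w < 4 * m" "?s w = u" using cycle_pred_exists u(1) .
    let ?N = "{w, ?s u, ?s (?s u)}"
    have N: "v < 4 * m \<and> cycle_adj n (f u) (f v)" if "v \<in> ?N" for v
      using that w u f adj_succ adj_succ2 cycle_adj_sym cycle_succ_less by auto
    then have ev: "even (f v)" if "v \<in> ?N" for v using that odd cycle_adj_odd_even by blast
    have "w \<noteq> ?s u \<and> w \<noteq> ?s (?s u) \<and> ?s u \<noteq> ?s (?s u)"
      using m w by (auto simp: cycle_succ_def split: if_splits)
    moreover have "v = v'" if "v \<in> ?N" "v' \<in> ?N" "f v mod 4 = f v' mod 4" for v v'
      using that N odd_neighbour_unique[OF odd, of n "f v" "f v'"] inj_onD[OF inj, of v v'] by simp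
    ultimately show False
      using mod_4_of_three[of "f w" "f (?s u)" "f (?s (?s u))"] ev by blast
  qed
  \<comment> \<open>The apex \<open>?s u\<close> completes a triangle whose other two vertices have
    even images, and even vertices span no triangle.\<close>
  have odd: "odd (f (?s u))" if u: "u < 4 * m" "even u" for u
  proof
    assume ev: "even (f (?s u))"
    have lt3: "?s u < 4 * m" "?s (?s u) < 4 * m" using u cycle_succ_less by blast+
    have "even (f u)" "even (f (?s (?s u)))"
      using even u lt3 parity_cycle_succ by auto
    moreover have "cycle_adj n (f u) (f (?s u))" "cycle_adj n (f (?s u)) (f (?s (?s u)))"
      "cycle_adj n (f u) (f (?s (?s u)))"
      using f u lt3 adj_succ adj_succ2 by auto
    ultimately show False
      using mod_4_of_three[of "f u" "f (?s u)" "f (?s (?s u))"] ev u lt lt3 by (simp add: cycle_adj_even)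
  qed
  have parity: "odd (f u) \<longleftrightarrow> odd u" if "u < 4 * m" for u
    using cycle_pred_exists[OF that] even[OF that] odd parity_cycle_succ by metis
  \<comment> \<open>One end of the image edge is odd, so it is a cycle edge; its direction may
    depend on \<open>u\<close> at this point.\<close>
  have step: "f (?s u) = cycle_succ n (f u) \<or> f u = cycle_succ n (f (?s u))" if u: "u < 4 * m" for u
  proof -
    have adj: "cycle_adj n (f u) (f (?s u))" using f adj_succ u cycle_succ_less by blast
    consider "odd (f u)" | "odd (f (?s u))" using parity odd u by blast
    then show ?thesis
      using cycle_adj_odd[of "f u" n "f (?s u)"] cycle_adj_odd[of "f (?s u)" n "f u"]
        adj cycle_adj_sym[OF adj] by cases auto
  qed
  \<comment> \<open>Both cycle neighbours of \<open>u\<close> are sent to distinct cycle neighbours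
    of \<open>f u\<close>, which has only two; one of the images is therefore the successor.\<close>
  have closed: "cycle_succ n v \<in> f ` {..<4 * m}" if "v \<in> f ` {..<4 * m}" for v
  proof -
    obtain u where u: "u < 4 * m" "v = f u" using \<open>v \<in> _\<close> by auto
    obtain w where w: "w < 4 * m" "?s w = u" using cycle_pred_exists u(1) .
    have "w \<noteq> ?s u" using m w by (auto simp: cycle_succ_def split: if_splits)
    then have "f w \<noteq> f (?s u)" using inj_onD[OF inj, of w "?s u"] w u cycle_succ_less by auto
    then have "cycle_succ n v = f w \<or> cycle_succ n v = f (?s u)"
      using step[OF w(1)] step[OF u(1)] w(2) u(2) cycle_succ_inject by metis
    then show ?thesis using w u cycle_succ_less by auto
  qed
  have up: "j < 4 * n \<longrightarrow> j \<in> f ` {..<4 * m}" if "i \<le> j" "i \<in> f ` {..<4 * m}" for i j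
    using that
  proof (induction j rule: dec_induct)
    case (step k)
    then show ?case using closed[of k] by (auto simp: cycle_succ_def split: if_splits)
  qed simp
  \<comment> \<open>Climbing from any image vertex reaches \<open>4 * n - 1\<close>, whose successor
    is \<open>0\<close>; climbing again from \<open>0\<close> covers every vertex.\<close>
  have f0: "f 0 \<in> f ` {..<4 * m}" "f 0 < 4 * n" using m lt by auto
  then have "4 * n - 1 \<in> f ` {..<4 * m}" using up[of "f 0" "4 * n - 1"] by simp
  then have "0 \<in> f ` {..<4 * m}" using closed[of "4 * n - 1"] f0 by (simp add: cycle_succ_def)
  then have "f ` {..<4 * m} = {..<4 * n}" using up[of 0] lt by auto
  then show ?thesis using card_image[OF inj] by simp
qed

theorem theorem3:
  shows "\<not> wqo_on induced_le
    {G :: nat pair_pre_digraph. pair_graph G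
      \<and> induced_free (complement_graph (disjoint_union (copies 2 (path_graph 1)) (path_graph 2))) G
      \<and> induced_free (disjoint_union (path_graph 2) (path_graph 4)) G
      \<and> induced_free (path_graph 6) G}"
proof
  \<comment> \<open>The shift by 2 meets the lower bound on \<open>n\<close> required for
    diamond-freeness and for the rigidity of embeddings.\<close>
  let ?x = "\<lambda>i. triangled_cycle (i + 2)"
  assume "wqo_on induced_le {G :: nat pair_pre_digraph. pair_graph G
      \<and> induced_free (complement_graph (disjoint_union (copies 2 (path_graph 1)) (path_graph 2))) G
      \<and> induced_free (disjoint_union (path_graph 2) (path_graph 4)) G
      \<and> induced_free (path_graph 6) G}"
  then obtain i j where "i < j" "induced_le (?x i) (?x j)"
    unfolding wqo_on_def
    using pair_graph_triangled_cycle triangled_cycle_diamond_free triangled_cycle_P2_P4_free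
      triangled_cycle_P6_free by (elim allE[of _ ?x]) auto
  then show False using triangled_cycle_embedding_imp_eq[of "i + 2" "j + 2"] by simp
qed

end
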